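(* For every $C\in \mathbb{N}$, there exist graphs $G$ and $H$ and a $(2,1)$-quasi-isometry $\phi\colon V(G)\to V(H)$ from $G$ to $H$ such that, for every edge weighting $w\colon E(H)\to \mathbb{R}^+$ of $H$, the map $\phi$ is not a $(1,C)$-quasi-isometry from $G$ to the weighted graph $(H,w)$.
   Context: An unweighted graph $G$ is viewed as the metric space $(V(G),\dist_G)$, where $\dist_G(x,y)$ is the minimum number of edges of an $(x,y)$-path. A weighted graph is a pair $(H,w)$ with $H$ a graph and $w\colon E(H)\to\mathbb{R}$; the length of a path is the sum of the weights of its edges, and $\dist_{(H,w)}(x,y)$ is the minimum length of an $(x,y)$-path in $H$. Given metric spaces $(X,d_X)$, $(Y,d_Y)$ and constants $L\ge 1$, $C\ge 0$, a map $\phi\colon X\to Y$ is an $(L,C)$-quasi-isometry if for all $x_1,x_2\in X$, $$L^{-1} d_X(x_1,x_2)-C\le d_Y(\phi(x_1),\phi(x_2))\le L\, d_X(x_1,x_2)+C,$$ and for every $y\in Y$ there is $x\in X$ with $d_Y(y,\phi(x))\le C$. *)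

theory Defs
  imports Complex_Main "Graph_Theory.Graph_Theory"
begin

text \<open>
  Graphs are finite, simple and undirected: an undirected edge \<open>uv\<close> of a \<^locale>\<open>pair_graph\<close>
  is the pair of arcs \<open>(u,v)\<close>, \<open>(v,u)\<close>. The distances below are meant for connected graphs,
  where the minima range over finite nonempty sets.
\<close>

definition graph_dist :: "'a pair_pre_digraph \<Rightarrow> 'a \<Rightarrow> 'a \<Rightarrow> real" where
  "graph_dist G x y = real (Min (length ` {p. pre_digraph.apath (with_proj G) x p y}))"

definition weighted_dist ::
    "'a pair_pre_digraph \<Rightarrow> ('a \<times> 'a) weight_fun \<Rightarrow> 'a \<Rightarrow> 'a \<Rightarrow> real" where
  "weighted_dist H w x y =
     Min (wf_digraph.awalk_cost w ` {p. pre_digraph.apath (with_proj H) x p y})"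

text \<open>Both arcs of an undirected edge carry the same weight.\<close>

definition pos_edge_weighting :: "'a pair_pre_digraph \<Rightarrow> ('a \<times> 'a) weight_fun \<Rightarrow> bool" where
  "pos_edge_weighting H w \<longleftrightarrow>
     (\<forall>(u, v) \<in> parcs H. 0 < w (u, v) \<and> w (u, v) = w (v, u))"

definition quasi_isometry ::
    "real \<Rightarrow> real \<Rightarrow> 'a set \<Rightarrow> ('a \<Rightarrow> 'a \<Rightarrow> real) \<Rightarrow> 'b set \<Rightarrow> ('b \<Rightarrow> 'b \<Rightarrow> real)
      \<Rightarrow> ('a \<Rightarrow> 'b) \<Rightarrow> bool" where
  "quasi_isometry L C X dX Y dY \<phi> \<longleftrightarrow>
     \<phi> ` X \<subseteq> Y \<and>
     (\<forall>x1\<in>X. \<forall>x2\<in>X. inverse L * dX x1 x2 - C \<le> dY (\<phi> x1) (\<phi> x2) \<and>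
                     dY (\<phi> x1) (\<phi> x2) \<le> L * dX x1 x2 + C) \<and>
     (\<forall>y\<in>Y. \<exists>x\<in>X. dY y (\<phi> x) \<le> C)"

end

theory Submission
  imports Defs
begin

text \<open>
  Let \<open>H\<close> be the butterfly with levels \<open>0, \<dots>, N\<close>, each level a copy of the integers modulo
  \<open>2 ^ N\<close>, in which the link of type \<open>t \<in> {0, 1}\<close> at \<open>(z, i)\<close> leads to \<open>(z + t 2 ^ i, i + 1)\<close>, and
  every link is subdivided into \<open>m\<close> edges. A node on level \<open>0\<close> and a node on level \<open>N\<close> are
  joined by exactly one path that uses only \<open>N\<close> links. Let \<open>G\<close> arise from \<open>H\<close> by adding, at every
  node, an edge that bypasses the node whenever an incoming and an outgoing link have different
  types, and let \<open>\<phi>\<close> be the identity.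

  If a weighting of \<open>H\<close> has additive error \<open>C\<close>, every link has weight at least \<open>m - 2 - C\<close>, so for
  large \<open>m\<close> short paths between the end levels must use \<open>N\<close> links. Routes of constant type have
  length \<open>m N\<close> in \<open>G\<close>, hence weight at least \<open>m N - C\<close>; routes of alternating type have length at
  most \<open>m N - N + 1\<close> in \<open>G\<close>, hence weight at most \<open>m N - N + 1 + C\<close>. Both families of routes are
  equally numerous and traverse each link exactly once, so their total weights agree, which is
  impossible for \<open>N > 2 C + 1\<close>.
\<close>

section \<open>Distances and potentials\<close>

lemma awalk_cost_eq_sum_list:
  fixes w :: "'b weight_fun"
  shows "wf_digraph.awalk_cost w p = sum_list (map w p)"
proof -
  have "wf_digraph (\<lparr>verts = {}, arcs = {}, tail = undefined, head = undefined\<rparr>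
      :: (unit, 'b) pre_digraph)"
    by unfold_locales auto
  from wf_digraph.awalk_cost_def[OF this] show ?thesis .
qed

locale connected_pair_graph = pair_graph +
  assumes connected: "Digraph_Component.connected (with_proj G)"
begin

lemma apath_exists:
  assumes "x \<in> pverts G" "y \<in> pverts G"
  shows "\<exists>p. apath x p y"
proof -
  have "strongly_connected (with_proj G)"
    using symmetric_connected_imp_strongly_connected pair_sym_arcs connected by blast
  then have "x \<rightarrow>\<^sup>*\<^bsub>with_proj G\<^esub> y"
    using assms by auto
  then show ?thesis by (simp add: reachable_apath)
qed

lemma weighted_dist_attained:
  assumes "x \<in> pverts G" "y \<in> pverts G"
  obtains p where "apath x p y" "weighted_dist G w x y = sum_list (map w p)"
proof -
  let ?S = "wf_digraph.awalk_cost w ` {p. apath x p y}"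
  have "Min ?S \<in> ?S"
    using apath_exists[OF assms] apaths_finite by (intro Min_in) auto
  then show thesis
    using that by (auto simp: weighted_dist_def awalk_cost_eq_sum_list)
qed

text \<open>Unit weights let weighted and unweighted distances share their lemmas.\<close>

lemma graph_dist_eq_weighted_dist:
  assumes "x \<in> pverts G" "y \<in> pverts G"
  shows "graph_dist G x y = weighted_dist G (\<lambda>_. 1) x y"
proof -
  have eq: "wf_digraph.awalk_cost (\<lambda>_. 1) = (\<lambda>p :: ('a \<times> 'a) list. real (length p))"
    by (simp add: fun_eq_iff awalk_cost_eq_sum_list sum_list_triv)
  have "real (Min (length ` {p. apath x p y})) = Min (real ` length ` {p. apath x p y})"
    using apath_exists[OF assms] apaths_finite by (intro mono_Min_commute) (auto intro: monoI)
  then show ?thesis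
    by (simp add: graph_dist_def weighted_dist_def eq image_image)
qed

text \<open>The minimum ranges over paths only; cutting cycles out of a walk never raises its cost
  when no weight is negative.\<close>

lemma weighted_dist_le_walk:
  assumes "awalk x p y" "\<And>e. e \<in> parcs G \<Longrightarrow> 0 \<le> w e"
  shows "weighted_dist G w x y \<le> sum_list (map w p)"
  using assms(1)
proof (induct rule: awalk_to_apath_induct)
  case (path p)
  then have "apath x p y" by (simp add: apath_def)
  then show ?case
    using apaths_finite by (auto simp: weighted_dist_def awalk_cost_eq_sum_list intro!: Min_le)
next
  case (decomp p q r s)
  have p: "p = q @ r @ s"
    using decomp(1-3) by (auto elim: awalk_cyc_decompE)
  have "set r \<subseteq> parcs G"
    using decomp(1) unfolding p by (auto simp: awalk_def)
  then have "0 \<le> sum_list (map w r)"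
    using assms(2) by (intro sum_list_nonneg) auto
  then show ?case using decomp(4) by (simp add: p)
qed

text \<open>The increments of \<open>F\<close> telescope along a cheapest path. This is the source
  of the lower bounds on distances below.\<close>

lemma potential_le_weighted_dist:
  assumes "x \<in> pverts G" "y \<in> pverts G"
    and F: "\<And>a b. (a, b) \<in> parcs G \<Longrightarrow> F b - F a \<le> w (a, b)"
  shows "F y - F x \<le> weighted_dist G w x y"
proof -
  have walk: "F b - F a \<le> sum_list (map w p)" if "pcas a p b" "set p \<subseteq> parcs G" for a p b
    using that
  proof (induct p arbitrary: a)
    case Nil
    then show ?case by simp
  next
    case (Cons e p)
    then have "F b - F (snd e) \<le> sum_list (map w p)" "F (snd e) - F a \<le> w e"
      using F[of "fst e" "snd e"] by auto
    then show ?case by simp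
  qed
  obtain p where "apath x p y" "weighted_dist G w x y = sum_list (map w p)"
    using weighted_dist_attained assms(1,2) by blast
  then show ?thesis
    using walk[of x p y] by (auto simp: apath_def awalk_def)
qed

lemma potential_le_graph_dist:
  assumes "x \<in> pverts G" "y \<in> pverts G" "0 < c"
    and F: "\<And>a b. (a, b) \<in> parcs G \<Longrightarrow> F b - F a \<le> c"
  shows "F y - F x \<le> c * graph_dist G x y"
proof -
  have "F y / c - F x / c \<le> weighted_dist G (\<lambda>_. 1) x y"
    using assms by (intro potential_le_weighted_dist)
      (auto simp: diff_divide_distrib[symmetric] field_simps)
  then show ?thesis
    using assms by (simp add: graph_dist_eq_weighted_dist field_simps)
qed

lemma weighted_dist_triangle:
  assumes "x \<in> pverts G" "y \<in> pverts G" "z \<in> pverts G"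
    and "\<And>e. e \<in> parcs G \<Longrightarrow> 0 \<le> w e"
  shows "weighted_dist G w x z \<le> weighted_dist G w x y + weighted_dist G w y z"
proof -
  obtain p where p: "apath x p y" "weighted_dist G w x y = sum_list (map w p)"
    using weighted_dist_attained assms by blast
  obtain q where q: "apath y q z" "weighted_dist G w y z = sum_list (map w q)"
    using weighted_dist_attained assms by blast
  have "awalk x (p @ q) z"
    using p(1) q(1) by (auto simp: apath_def)
  then show ?thesis
    using weighted_dist_le_walk[of x "p @ q" z w] assms(4) p q by simp
qed

lemma weighted_dist_le_sum:
  assumes "\<And>e. e \<in> parcs G \<Longrightarrow> 0 \<le> w e" "f 0 \<in> pverts G"
    and "\<And>k. k < n \<Longrightarrow> (f k, f (Suc k)) \<in> parcs G"
  shows "weighted_dist G w (f 0) (f n) \<le> (\<Sum>k<n. w (f k, f (Suc k)))"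
proof -
  let ?p = "map (\<lambda>k. (f k, f (Suc k))) [0..<n]"
  have "awalk (f 0) ?p (f n)"
    using assms(3)
  proof (induct n)
    case 0
    then show ?case using assms(2) by (simp add: awalk_Nil_iff)
  next
    case (Suc n)
    then have "awalk (f n) [(f n, f (Suc n))] (f (Suc n))"
      by (auto simp: awalk_simps intro: in_arcsD1 in_arcsD2)
    with Suc show ?case by simp
  qed
  then have "weighted_dist G w (f 0) (f n) \<le> sum_list (map w ?p)"
    using assms(1) by (rule weighted_dist_le_walk)
  also have "\<dots> = (\<Sum>k<n. w (f k, f (Suc k)))"
    by (simp add: comp_def interv_sum_list_conv_sum_set_nat atLeast0LessThan)
  finally show ?thesis .
qed

lemma graph_dist_triangle:
  assumes "x \<in> pverts G" "y \<in> pverts G" "z \<in> pverts G"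
  shows "graph_dist G x z \<le> graph_dist G x y + graph_dist G y z"
  using assms weighted_dist_triangle by (simp add: graph_dist_eq_weighted_dist)

lemma graph_dist_le_length:
  assumes "f 0 \<in> pverts G" "\<And>k. k < n \<Longrightarrow> (f k, f (Suc k)) \<in> parcs G"
  shows "graph_dist G (f 0) (f n) \<le> n"
proof -
  have "f n \<in> pverts G"
    using assms by (cases n) (auto intro: in_arcsD2)
  then show ?thesis
    using weighted_dist_le_sum[of "\<lambda>_. 1" f n] assms by (simp add: graph_dist_eq_weighted_dist)
qed

lemma graph_dist_refl: "x \<in> pverts G \<Longrightarrow> graph_dist G x x \<le> 0"
  using graph_dist_le_length[of "\<lambda>_. x" 0] by simp

lemma graph_dist_arc: "(x, y) \<in> parcs G \<Longrightarrow> graph_dist G x y \<le> 1"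
  using graph_dist_le_length[of "\<lambda>k. if k = 0 then x else y" 1] by (auto intro: in_arcsD1)

end

lemma connected_pair_graph_symmetric_closure:
  assumes "finite V" "A \<subseteq> V \<times> V" "irrefl A" "r \<in> V"
    and reach: "\<And>v. v \<in> V \<Longrightarrow> (r, v) \<in> (A \<union> A\<inverse>)\<^sup>*"
  shows "connected_pair_graph \<lparr>pverts = V, parcs = A \<union> A\<inverse>\<rparr>"
proof -
  let ?G = "\<lparr>pverts = V, parcs = A \<union> A\<inverse>\<rparr>"
  have fin: "finite A" using assms(1,2) by (meson finite_SigmaI finite_subset)
  interpret pair_graph ?G
    using assms fin
    by unfold_locales (auto simp: symmetric_def sym_def irrefl_def)
  have "u \<rightarrow>\<^sup>*\<^bsub>with_proj ?G\<^esub> v" if "u \<in> V" "v \<in> V" for u v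
  proof -
    have reach': "r \<rightarrow>\<^sup>*\<^bsub>with_proj ?G\<^esub> x" if "x \<in> V" for x
      using reach[OF that] assms(4) that by (subst reachable_conv) auto
    show ?thesis
      using reachable_trans[OF symmetric_reachable'[OF reach'] reach'] that by blast
  qed
  then have "strongly_connected (with_proj ?G)"
    using assms(4) by (intro strongly_connectedI) auto
  then have "Digraph_Component.connected (with_proj ?G)"
    using reachable_mk_symmetricI
    by (auto simp: Digraph_Component.connected_def strongly_connected_def)
  then show ?thesis by unfold_locales
qed

section \<open>The subdivided butterfly\<close>

locale butterfly =
  fixes N m :: nat
  assumes N_pos: "0 < N" and m_ge: "3 \<le> m"
begin

definition K :: nat where "K = 2 ^ N"

definition up :: "nat \<Rightarrow> nat \<Rightarrow> bool \<Rightarrow> nat" where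
  "up z i t = (z + of_bool t * 2 ^ i) mod K"

definition node :: "nat \<Rightarrow> nat \<Rightarrow> nat" where
  "node z i = to_nat (z, i, False, 0 :: nat)"

text \<open>The ends of a link are nodes, shared with other links; only interior points carry the
  code of their own link, and \<open>j = 0\<close> in a code is reserved for nodes.\<close>

definition pt :: "nat \<Rightarrow> nat \<Rightarrow> bool \<Rightarrow> nat \<Rightarrow> nat" where
  "pt z i t j = (if j = 0 then node z i else if j = m then node (up z i t) (Suc i)
     else to_nat (z, i, t, j))"

definition V :: "nat set" where
  "V = {pt z i t j | z i t j. z < K \<and> i < N \<and> j \<le> m}"

definition A :: "nat rel" where
  "A = {(pt z i t j, pt z i t (Suc j)) | z i t j. z < K \<and> i < N \<and> j < m}"

definition S :: "nat rel" where
  "S = {(pt z i t (m - 1), pt (up z i t) (Suc i) (\<not> t) 1) | z i t. z < K \<and> Suc i < N}"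

definition H :: "nat pair_pre_digraph" where
  "H = \<lparr>pverts = V, parcs = A \<union> A\<inverse>\<rparr>"

definition G :: "nat pair_pre_digraph" where
  "G = \<lparr>pverts = V, parcs = (A \<union> S) \<union> (A \<union> S)\<inverse>\<rparr>"

lemma K_pos: "0 < K" by (simp add: K_def)

lemma up_less: "up z i t < K" using K_pos by (simp add: up_def)

lemma up_False: "z < K \<Longrightarrow> up z i False = z" by (simp add: up_def)

lemma pt_0 [simp]: "pt z i t 0 = node z i" by (simp add: pt_def)

lemma pt_m [simp]: "pt z i t m = node (up z i t) (Suc i)" using m_ge by (simp add: pt_def)

lemma pt_in_V: "z < K \<Longrightarrow> i < N \<Longrightarrow> j \<le> m \<Longrightarrow> pt z i t j \<in> V"
  unfolding V_def by blast

lemma node_in_V: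
  assumes "z < K" "i \<le> N"
  shows "node z i \<in> V"
proof (cases "i < N")
  case True
  then show ?thesis using pt_in_V[OF assms(1) True, of 0] by simp
next
  case False
  \<comment> \<open>No link starts on level \<open>N\<close>; its nodes occur as upper ends of links
    of type \<open>False\<close>, which keep \<open>z\<close>.\<close>
  then have "i = Suc (N - 1)" using assms N_pos by simp
  then show ?thesis
    using pt_in_V[OF assms(1), of "N - 1" m False] N_pos pt_m[of z "N - 1" False]
    by (simp add: up_False assms)
qed

lemma finite_V: "finite V"
proof -
  have "V = (\<lambda>(z, i, t, j). pt z i t j) ` ({..<K} \<times> {..<N} \<times> UNIV \<times> {..m})"
    by (auto simp: V_def image_def)
  then show ?thesis by simp
qed

lemma A_I: "z < K \<Longrightarrow> i < N \<Longrightarrow> j < m \<Longrightarrow> (pt z i t j, pt z i t (Suc j)) \<in> A"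
  unfolding A_def by blast

lemma A_subset: "A \<subseteq> V \<times> V"
  by (auto simp: A_def intro!: pt_in_V)

lemma S_subset: "S \<subseteq> V \<times> V"
  using m_ge by (auto simp: S_def intro!: pt_in_V up_less)

lemma irrefl_A: "irrefl A"
  using m_ge by (auto simp: irrefl_def A_def pt_def node_def split: if_splits)

lemma irrefl_S: "irrefl S"
  using m_ge by (auto simp: irrefl_def S_def pt_def node_def split: if_splits)

text \<open>Going up a link of type \<open>True\<close> from level 0 and back down one of type
  \<open>False\<close> moves from \<open>z\<close> to \<open>z + 1\<close>; climbing links of type
  \<open>False\<close> then gives all levels.\<close>

lemma A_reaches_all:
  assumes "v \<in> V"
  shows "(node 0 0, v) \<in> (A \<union> A\<inverse>)\<^sup>*" (is "_ \<in> ?R\<^sup>*")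
proof -
  have sym: "sym (?R\<^sup>*)"
    by (intro sym_rtrancl sym_Un_converse)
  have link: "(node z i, pt z i t j) \<in> ?R\<^sup>*" if "z < K" "i < N" "j \<le> m" for z i t j
    using that(3)
  proof (induction j)
    case (Suc j)
    then have "(pt z i t j, pt z i t (Suc j)) \<in> ?R"
      using that by (simp add: A_I)
    with Suc show ?case by (meson Suc_leD rtrancl.rtrancl_into_rtrancl)
  qed simp
  have up: "(node z i, node (up z i t) (Suc i)) \<in> ?R\<^sup>*" if "z < K" "i < N" for z i t
    using link[OF that, of m t] by simp
  have level: "(node z 0, node z i) \<in> ?R\<^sup>*" if "z < K" "i \<le> N" for z i
    using that(2)
  proof (induction i)
    case (Suc i)
    then show ?case
      using up[of z i False] that(1) by (auto simp: up_False intro: rtrancl_trans)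
  qed simp
  have bottom: "(node 0 0, node z 0) \<in> ?R\<^sup>*" if "z < K" for z
    using that
  proof (induction z)
    case (Suc z)
    have "(node z 0, node (Suc z) (Suc 0)) \<in> ?R\<^sup>*"
      using up[of z 0 True] Suc.prems N_pos by (simp add: up_def)
    moreover have "(node (Suc z) (Suc 0), node (Suc z) 0) \<in> ?R\<^sup>*"
      using level[of "Suc z" "Suc 0"] Suc.prems N_pos sym by (auto dest: symD)
    ultimately show ?case using Suc by (meson Suc_lessD rtrancl_trans)
  qed simp
  obtain z i t j where "v = pt z i t j" "z < K" "i < N" "j \<le> m"
    using assms by (auto simp: V_def)
  then show ?thesis
    using bottom[of z] level[of z i] link[of z i j t] by (meson less_imp_le rtrancl_trans)
qed

sublocale H: connected_pair_graph H
  unfolding H_def using finite_V A_subset irrefl_A node_in_V[OF K_pos, of 0] A_reaches_all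
  by (intro connected_pair_graph_symmetric_closure) auto

sublocale G: connected_pair_graph G
  unfolding G_def
proof (intro connected_pair_graph_symmetric_closure)
  show "finite V" "A \<union> S \<subseteq> V \<times> V" "node 0 0 \<in> V"
    using finite_V A_subset S_subset node_in_V[OF K_pos, of 0] by auto
  show "irrefl (A \<union> S)"
    using irrefl_A irrefl_S by (auto simp: irrefl_def)
  show "(node 0 0, v) \<in> (A \<union> S \<union> (A \<union> S)\<inverse>)\<^sup>*" if "v \<in> V" for v
    using A_reaches_all[OF that] by (rule subsetD[OF rtrancl_mono, rotated]) auto
qed

lemma pverts_G [simp]: "pverts G = V" and pverts_H [simp]: "pverts H = V"
  by (simp_all add: G_def H_def)

section \<open>The identity map between the two graphs\<close>

lemma quasi_isometry_id: "quasi_isometry 2 1 V (graph_dist G) V (graph_dist H) id"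
proof -
  have HG: "graph_dist G x y \<le> graph_dist H x y" if "x \<in> V" "y \<in> V" for x y
  proof -
    \<comment> \<open>The distance from \<open>x\<close> in one graph serves as a potential in the
      other.\<close>
    have "graph_dist G x y - graph_dist G x x \<le> 1 * graph_dist H x y"
    proof (rule H.potential_le_graph_dist)
      show "graph_dist G x b - graph_dist G x a \<le> 1" if "(a, b) \<in> parcs H" for a b
      proof -
        have "(a, b) \<in> parcs G" using that by (auto simp: G_def H_def)
        then show ?thesis
          using G.graph_dist_triangle[of x a b] G.graph_dist_arc[of a b] \<open>x \<in> V\<close>
            G.in_arcsD1[of a b] G.in_arcsD2[of a b] by simp
      qed
    qed (use that in auto)
    then show ?thesis using G.graph_dist_refl[of x] that by simp
  qed
  have S2: "graph_dist H a b \<le> 2" if "(a, b) \<in> S \<union> S\<inverse>" for a b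
  proof -
    have "graph_dist H a b \<le> 2 \<and> graph_dist H b a \<le> 2" if "(a, b) \<in> S" for a b
    proof -
      obtain z i t where ab: "a = pt z i t (m - 1)" "b = pt (up z i t) (Suc i) (\<not> t) 1"
        and *: "z < K" "Suc i < N"
        using \<open>(a, b) \<in> S\<close> unfolding S_def by blast
      \<comment> \<open>The bypassed node: in \<open>H\<close> the two edges through it replace the
        shortcut.\<close>
      define c where "c = node (up z i t) (Suc i)"
      have ac: "(a, c) \<in> A"
        using A_I[of z i "m - 1" t] * m_ge by (simp add: ab c_def)
      have cb: "(c, b) \<in> A"
        using A_I[of "up z i t" "Suc i" 0 "\<not> t"] * m_ge up_less by (simp add: ab c_def)
      have "(a, c) \<in> parcs H" "(c, b) \<in> parcs H" "(c, a) \<in> parcs H" "(b, c) \<in> parcs H"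
        using ac cb by (auto simp: H_def)
      moreover have "a \<in> V" "b \<in> V" "c \<in> V"
        using ac cb A_subset by auto
      ultimately show ?thesis
        using H.graph_dist_triangle[of a c b] H.graph_dist_triangle[of b c a]
          H.graph_dist_arc[of a c] H.graph_dist_arc[of c b]
          H.graph_dist_arc[of b c] H.graph_dist_arc[of c a] by simp
    qed
    then show ?thesis using that by blast
  qed
  have GH: "graph_dist H x y \<le> 2 * graph_dist G x y" if "x \<in> V" "y \<in> V" for x y
  proof -
    have "graph_dist H x y - graph_dist H x x \<le> 2 * graph_dist G x y"
    proof (rule G.potential_le_graph_dist)
      show "graph_dist H x b - graph_dist H x a \<le> 2" if ab: "(a, b) \<in> parcs G" for a b
      proof -
        have "a \<in> V" "b \<in> V" using G.in_arcsD1 G.in_arcsD2 ab by auto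
        moreover have "graph_dist H a b \<le> 2"
        proof (cases "(a, b) \<in> parcs H")
          case True
          then show ?thesis using H.graph_dist_arc[of a b] by simp
        next
          case False
          then show ?thesis using S2 ab by (auto simp: G_def H_def)
        qed
        ultimately show ?thesis
          using H.graph_dist_triangle[of x a b] \<open>x \<in> V\<close> by simp
      qed
    qed (use that in auto)
    then show ?thesis using H.graph_dist_refl[of x] that by simp
  qed
  have nonneg: "0 \<le> graph_dist G x y" for x y by (simp add: graph_dist_def)
  have "inverse 2 * graph_dist G x y - 1 \<le> graph_dist H x y \<and>
      graph_dist H x y \<le> 2 * graph_dist G x y + 1" if "x \<in> V" "y \<in> V" for x y
    using HG[OF that] GH[OF that] nonneg[of x y] by auto
  moreover have "\<exists>x\<in>V. graph_dist H y x \<le> 1" if "y \<in> V" for y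
    using H.graph_dist_refl[of y] that by (intro bexI[of _ y]) auto
  ultimately show ?thesis
    by (auto simp: quasi_isometry_def)
qed

section \<open>Potentials prescribed on the nodes\<close>

text \<open>A Lipschitz extension of McShane type into each link: the value at an end plus the
  length of the way to it, minimised over both ends.\<close>

definition ext :: "(nat \<Rightarrow> nat \<Rightarrow> real) \<Rightarrow> (nat \<Rightarrow> nat \<Rightarrow> bool \<Rightarrow> nat \<Rightarrow> real) \<Rightarrow> nat \<Rightarrow> real" where
  "ext f \<omega> n = (case from_nat n of (z, i, t, j) \<Rightarrow> if j = 0 then f z i else
     min (f z i + (\<Sum>k<j. \<omega> z i t k)) (f (up z i t) (Suc i) + (\<Sum>k=j..<m. \<omega> z i t k)))"

lemma ext_node: "ext f \<omega> (node z i) = f z i"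
  by (simp add: ext_def node_def)

text \<open>By the hypothesis neither end is undercut by the detour through the other, so the
  formula also returns \<open>f\<close> at \<open>j = 0\<close> and \<open>j = m\<close>.\<close>

lemma ext_pt:
  assumes "\<bar>f (up z i t) (Suc i) - f z i\<bar> \<le> (\<Sum>k<m. \<omega> z i t k)"
  shows "ext f \<omega> (pt z i t j) =
    min (f z i + (\<Sum>k<j. \<omega> z i t k)) (f (up z i t) (Suc i) + (\<Sum>k=j..<m. \<omega> z i t k))"
proof (cases "j = 0 \<or> j = m")
  case True
  then show ?thesis
    using assms by (auto simp: ext_node atLeast0LessThan min_def)
next
  case False
  then show ?thesis by (simp add: pt_def ext_def)
qed

lemma ext_step:
  assumes "\<bar>f (up z i t) (Suc i) - f z i\<bar> \<le> (\<Sum>k<m. \<omega> z i t k)" "0 \<le> \<omega> z i t j" "j < m"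
  shows "\<bar>ext f \<omega> (pt z i t (Suc j)) - ext f \<omega> (pt z i t j)\<bar> \<le> \<omega> z i t j"
proof -
  have "(\<Sum>k=j..<m. \<omega> z i t k) = \<omega> z i t j + (\<Sum>k=Suc j..<m. \<omega> z i t k)"
    using assms(3) by (simp add: sum.atLeast_Suc_lessThan)
  then show ?thesis
    using assms(2) unfolding ext_pt[where f=f and \<omega>=\<omega>, OF assms(1)]
    by (auto simp: min_def abs_le_iff)
qed

lemma node_potential_le_weighted_dist:
  assumes w: "pos_edge_weighting H w"
    and f: "\<And>z i t. z < K \<Longrightarrow> i < N \<Longrightarrow>
      \<bar>f (up z i t) (Suc i) - f z i\<bar> \<le> (\<Sum>j<m. w (pt z i t j, pt z i t (Suc j)))"
    and "z < K" "i \<le> N" "z' < K" "i' \<le> N"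
  shows "f z' i' - f z i \<le> weighted_dist H w (node z i) (node z' i')"
proof -
  define \<omega> where "\<omega> = (\<lambda>z i t j. w (pt z i t j, pt z i t (Suc j)))"
  have "ext f \<omega> (node z' i') - ext f \<omega> (node z i) \<le> weighted_dist H w (node z i) (node z' i')"
  proof (rule H.potential_le_weighted_dist)
    fix a b
    assume "(a, b) \<in> parcs H"
    moreover have "w (x, y) = w (y, x) \<and> \<bar>ext f \<omega> y - ext f \<omega> x\<bar> \<le> w (x, y)" if "(x, y) \<in> A" for x y
    proof -
      obtain z i t j where *: "x = pt z i t j" "y = pt z i t (Suc j)" "z < K" "i < N" "j < m"
        using \<open>(x, y) \<in> A\<close> unfolding A_def by blast
      have "0 < w (x, y)" "w (x, y) = w (y, x)"
        using w that by (auto simp: pos_edge_weighting_def H_def)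
      then show ?thesis
        using ext_step[of f z i t \<omega> j] f[of z i t] * by (simp add: \<omega>_def)
    qed
    ultimately show "ext f \<omega> b - ext f \<omega> a \<le> w (a, b)"
      by (fastforce simp: H_def)
  qed (use assms node_in_V in auto)
  then show ?thesis by (simp add: ext_node)
qed

text \<open>A shortcut joins links of different types, so a potential in which only the links of one type
  have full length, and the others lose both end edges, is still 1-Lipschitz across shortcuts.\<close>

lemma node_potential_le_graph_dist:
  assumes f: "\<And>z i t. z < K \<Longrightarrow> i < N \<Longrightarrow>
      \<bar>f (up z i t) (Suc i) - f z i\<bar> \<le> (if t = b then real m else real m - 2)"
    and "z < K" "i \<le> N" "z' < K" "i' \<le> N"
  shows "f z' i' - f z i \<le> graph_dist G (node z i) (node z' i')"
proof -
  \<comment> \<open>Unit lengths on links of type \<open>b\<close>; the others lose their first and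
    last edge, which gives total lengths \<open>m\<close> and \<open>m - 2\<close>.\<close>
  define \<omega> :: "nat \<Rightarrow> nat \<Rightarrow> bool \<Rightarrow> nat \<Rightarrow> real"
    where "\<omega> = (\<lambda>z i t j. if t = b \<or> j \<in> {1..<m - 1} then 1 else 0)"
  have sum: "(\<Sum>j<m. \<omega> z i t j) = (if t = b then real m else real m - 2)" for z i t
  proof (cases "t = b")
    case False
    have "(\<Sum>j<m. \<omega> z i t j) = (\<Sum>j\<in>{1..<m - 1}. 1)"
      using False by (intro sum.mono_neutral_cong_right) (auto simp: \<omega>_def)
    then show ?thesis using False m_ge by (simp add: of_nat_diff)
  qed (simp add: \<omega>_def)
  have step: "\<bar>ext f \<omega> (pt z i t (Suc j)) - ext f \<omega> (pt z i t j)\<bar> \<le> \<omega> z i t j"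
    if "z < K" "i < N" "j < m" for z i t j
    using ext_step[of f z i t \<omega> j] f[of z i t] that by (simp add: sum) (simp add: \<omega>_def)
  have A: "\<bar>ext f \<omega> y - ext f \<omega> x\<bar> \<le> 1" if "(x, y) \<in> A" for x y
  proof -
    obtain z i t j where *: "x = pt z i t j" "y = pt z i t (Suc j)" "z < K" "i < N" "j < m"
      using \<open>(x, y) \<in> A\<close> unfolding A_def by blast
    then have "\<bar>ext f \<omega> y - ext f \<omega> x\<bar> \<le> \<omega> z i t j" using step by blast
    also have "\<dots> \<le> 1" by (simp add: \<omega>_def)
    finally show ?thesis .
  qed
  have S: "\<bar>ext f \<omega> y - ext f \<omega> x\<bar> \<le> 1" if "(x, y) \<in> S" for x y
  proof -
    obtain z i t where *: "x = pt z i t (m - 1)" "y = pt (up z i t) (Suc i) (\<not> t) 1"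
      "z < K" "Suc i < N"
      using \<open>(x, y) \<in> S\<close> unfolding S_def by blast
    let ?c = "node (up z i t) (Suc i)"
    have "\<bar>ext f \<omega> ?c - ext f \<omega> x\<bar> \<le> \<omega> z i t (m - 1)"
      using step[of z i "m - 1" t] * m_ge by simp
    moreover have "\<bar>ext f \<omega> y - ext f \<omega> ?c\<bar> \<le> \<omega> (up z i t) (Suc i) (\<not> t) 0"
      using step[of "up z i t" "Suc i" 0 "\<not> t"] * m_ge up_less by simp
    \<comment> \<open>The two links have types \<open>t\<close> and \<open>\<not> t\<close>, so only
      one of the end edges at the bypassed node has length 1.\<close>
    moreover have "\<omega> z i t (m - 1) + \<omega> (up z i t) (Suc i) (\<not> t) 0 \<le> 1"
      by (auto simp: \<omega>_def)
    ultimately show ?thesis by linarith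
  qed
  have "ext f \<omega> (node z' i') - ext f \<omega> (node z i) \<le> 1 * graph_dist G (node z i) (node z' i')"
  proof (rule G.potential_le_graph_dist)
    show "ext f \<omega> b - ext f \<omega> a \<le> 1" if "(a, b) \<in> parcs G" for a b
      using that A[of a b] A[of b a] S[of a b] S[of b a] by (auto simp: G_def)
  qed (use assms node_in_V in auto)
  then show ?thesis by (simp add: ext_node)
qed

section \<open>Routes between the end levels\<close>

text \<open>The binary number with digits \<open>t 0\<close>, ..., \<open>t (i - 1)\<close>: the
  displacement after \<open>i\<close> links of types \<open>t\<close>. Uniqueness of binary digits
  makes upward paths unique.\<close>

definition off :: "(nat \<Rightarrow> bool) \<Rightarrow> nat \<Rightarrow> nat" where
  "off t i = (\<Sum>k<i. of_bool (t k) * 2 ^ k)"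

definition route :: "nat \<Rightarrow> (nat \<Rightarrow> bool) \<Rightarrow> nat \<Rightarrow> nat" where
  "route u t i = (u + off t i) mod K"

definition route_len :: "(nat \<Rightarrow> nat \<Rightarrow> bool \<Rightarrow> real) \<Rightarrow> nat \<Rightarrow> (nat \<Rightarrow> bool) \<Rightarrow> nat \<Rightarrow> real" where
  "route_len l u t i = (\<Sum>k<i. l (route u t k) k (t k))"

lemma off_less: "off t i < 2 ^ i"
  by (induction i) (auto simp: off_def)

lemma route_0: "u < K \<Longrightarrow> route u t 0 = u"
  by (simp add: route_def off_def)

lemma route_less: "route u t i < K"
  using K_pos by (simp add: route_def)

lemma route_Suc: "route u t (Suc i) = up (route u t i) i (t i)"
  by (simp add: route_def up_def off_def mod_simps add.assoc)

text \<open>The nodes with \<open>y < 2 ^ i\<close> are those reachable from \<open>(u, 0)\<close> by going up only, each by a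
  unique path. Leaving this cone means going down a link, which costs two extra links.\<close>

definition pot :: "(nat \<Rightarrow> nat \<Rightarrow> bool \<Rightarrow> real) \<Rightarrow> real \<Rightarrow> nat \<Rightarrow> (nat \<Rightarrow> bool) \<Rightarrow> nat \<Rightarrow> nat \<Rightarrow> real" where
  "pot l \<mu> u t z i = (let y = (z + (K - u)) mod K in
     if y < 2 ^ i then
       if y = off t i then min (route_len l u t i) ((real i + 1) * \<mu>) else real i * \<mu>
     else (real i + 2) * \<mu>)"

text \<open>On the route a step changes the potential by at most the length of the link; every other
  link changes it by at most \<open>\<mu>\<close>, the lower bound for all lengths.\<close>

lemma pot_step:
  assumes "u < K" "z < K" "i < N" "0 \<le> \<mu>"
    and l: "\<And>z i t. z < K \<Longrightarrow> i < N \<Longrightarrow> \<mu> \<le> l z i t"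
  shows "\<bar>pot l \<mu> u t (up z i s) (Suc i) - pot l \<mu> u t z i\<bar> \<le> l z i s"
proof -
  \<comment> \<open>Position relative to \<open>u\<close>; adding \<open>K - u\<close> replaces
    subtraction modulo \<open>K\<close>.\<close>
  define y where "y = (z + (K - u)) mod K"
  define y' where "y' = (up z i s + (K - u)) mod K"
  have y': "y' = (y + of_bool s * 2 ^ i) mod K"
    by (simp add: y'_def y_def up_def mod_simps ac_simps)
  have len: "real j * \<mu> \<le> route_len l u t j" if "j \<le> N" for j
  proof -
    have "(\<Sum>k<j. \<mu>) \<le> route_len l u t j"
      unfolding route_len_def using that by (intro sum_mono l route_less) auto
    then show ?thesis by simp
  qed
  have lz: "\<mu> \<le> l z i s" using l assms by blast
  show ?thesis
  proof (cases "y < 2 ^ i")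
    case False
    have "pot l \<mu> u t z i = (real i + 2) * \<mu>"
      using False unfolding pot_def Let_def y_def[symmetric] by simp
    \<comment> \<open>The upper node may lie in the larger cone of level \<open>i + 1\<close> or
      outside it; either way its value is within \<open>\<mu>\<close> of
      \<open>(i + 2) \<mu>\<close>.\<close>
    moreover have "(real i + 1) * \<mu> \<le> pot l \<mu> u t (up z i s) (Suc i)"
      "pot l \<mu> u t (up z i s) (Suc i) \<le> (real i + 3) * \<mu>"
      using len[of "Suc i"] assms(3,4) by (auto simp: pot_def Let_def algebra_simps)
    ultimately show ?thesis using lz by (simp add: algebra_simps abs_le_iff)
  next
    case True
    \<comment> \<open>Inside the cone the position cannot wrap around modulo \<open>K\<close>,
      because \<open>i < N\<close>.\<close>
    have "(2::nat) ^ Suc i \<le> K"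
      unfolding K_def using assms(3) by (intro power_increasing) auto
    moreover have "y + of_bool s * 2 ^ i < 2 ^ Suc i"
      using True by auto
    ultimately have y'_eq: "y' = y + of_bool s * 2 ^ i" and y'_less: "y' < 2 ^ Suc i"
      by (simp_all add: y')
    have eq_off: "y' = off t (Suc i) \<longleftrightarrow> y = off t i \<and> s = t i"
      using True off_less[of t i] by (auto simp: y'_eq off_def)
    have up: "pot l \<mu> u t (up z i s) (Suc i) = (if y = off t i \<and> s = t i
        then min (route_len l u t (Suc i)) ((real i + 2) * \<mu>) else (real i + 1) * \<mu>)"
      using y'_less unfolding eq_off[symmetric] pot_def Let_def y'_def[symmetric]
      by (simp add: add.commute)
    show ?thesis
    proof (cases "y = off t i")
      case False
      then show ?thesis
        using True up lz assms(4) unfolding pot_def[of l \<mu> u t z i] Let_def y_def[symmetric]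
        by (simp add: algebra_simps)
    next
      case y: True
      have "z = route u t i"
      proof -
        have "route u t i = (u + (z + (K - u))) mod K"
          unfolding route_def y[symmetric] y_def by (simp add: mod_simps)
        also have "\<dots> = z" using assms(1,2) by simp
        finally show ?thesis ..
      qed
      then have "route_len l u t (Suc i) = route_len l u t i + l z i (t i)"
        by (simp add: route_len_def)
      moreover have "pot l \<mu> u t z i = min (route_len l u t i) ((real i + 1) * \<mu>)"
        using y True unfolding pot_def Let_def y_def[symmetric] by simp
      moreover have "real i * \<mu> \<le> route_len l u t i" using len assms(3) by simp
      ultimately show ?thesis
        using up y lz assms(4) by (auto simp: min_def abs_le_iff algebra_simps)
    qed
  qed
qed

lemma pot_start: "u < K \<Longrightarrow> 0 \<le> \<mu> \<Longrightarrow> pot l \<mu> u t u 0 = 0"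
  by (simp add: pot_def off_def route_len_def)

text \<open>Together with \<open>pot_start\<close> this yields the lower bound on the distance
  between the ends of a route; for large \<open>m\<close> the minimum is the route length.\<close>

lemma pot_end:
  assumes "u < K"
  shows "pot l \<mu> u t (route u t N) N = min (route_len l u t N) ((real N + 1) * \<mu>)"
proof -
  have "(route u t N + (K - u)) mod K = off t N"
    using off_less[of t N] assms unfolding route_def mod_add_left_eq K_def[symmetric] by simp
  then show ?thesis using off_less[of t N] by (simp add: pot_def)
qed

text \<open>Types change at each of the \<open>N - 1\<close> inner nodes, so all of them are
  bypassed, and each bypass saves one of the \<open>m N\<close> edges.\<close>

lemma alternating_route_dist:
  assumes "u < K" and t: "\<And>k. t (Suc k) = (\<not> t k)"
  shows "graph_dist G (node u 0) (node (route u t N) N) \<le> real m * real N - real N + 1"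
proof -
  define p where "p i = pt (route u t i) i (t i)" for i
  have arc: "(p i j, p i (Suc j)) \<in> parcs G" if "i < N" "j < m" for i j
    using A_I route_less that by (simp add: p_def G_def)
  have inV: "p i j \<in> V" if "i < N" "j \<le> m" for i j
    using pt_in_V route_less that by (simp add: p_def)
  \<comment> \<open>Measured up to the first interior point of each link: from there to the next
    such point are \<open>m - 2\<close> edges and one shortcut.\<close>
  have first: "graph_dist G (node u 0) (p i 1) \<le> 1 + real i * (real m - 1)" if "i < N" for i
    using that
  proof (induction i)
    case 0
    then show ?case
      using arc[of 0 0] m_ge G.graph_dist_arc[of "p 0 0" "p 0 1"] assms(1)
      by (simp add: p_def route_0)
  next
    case (Suc i)
    have "graph_dist G (p i 1) (p i (m - 1)) \<le> real (m - 2)"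
    proof -
      have "graph_dist G (p i (0 + 1)) (p i (m - 2 + 1)) \<le> real (m - 2)"
        using Suc.prems m_ge arc inV by (intro G.graph_dist_le_length[where f="\<lambda>k. p i (k + 1)"]) auto
      moreover have "m - 2 + 1 = m - 1" using m_ge by simp
      ultimately show ?thesis by simp
    qed
    moreover have "graph_dist G (p i (m - 1)) (p (Suc i) 1) \<le> 1"
    proof (rule G.graph_dist_arc)
      have "(p i (m - 1), p (Suc i) 1) \<in> S"
        unfolding S_def p_def route_Suc t using Suc.prems route_less by blast
      then show "(p i (m - 1), p (Suc i) 1) \<in> parcs G" by (simp add: G_def)
    qed
    moreover have "node u 0 \<in> V" "p i 1 \<in> V" "p i (m - 1) \<in> V" "p (Suc i) 1 \<in> V"
      using node_in_V[OF assms(1), of 0] inV Suc.prems m_ge by auto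
    ultimately have "graph_dist G (node u 0) (p (Suc i) 1)
        \<le> graph_dist G (node u 0) (p i 1) + real (m - 2) + 1"
      using G.graph_dist_triangle[of "node u 0" "p i 1" "p i (m - 1)"]
        G.graph_dist_triangle[of "node u 0" "p i (m - 1)" "p (Suc i) 1"] by simp
    then show ?case using Suc m_ge by (simp add: of_nat_diff algebra_simps)
  qed
  define n where "n = N - 1"
  have n: "Suc n = N" "n < N" using N_pos by (auto simp: n_def)
  have "graph_dist G (p n (0 + 1)) (p n (m - 1 + 1)) \<le> real (m - 1)"
    using n m_ge arc inV by (intro G.graph_dist_le_length[where f="\<lambda>k. p n (k + 1)"]) auto
  moreover have "p n (m - 1 + 1) = node (route u t N) N"
    using m_ge pt_m by (simp add: p_def n(1) route_Suc[symmetric])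
  moreover have "graph_dist G (node u 0) (node (route u t N) N)
      \<le> graph_dist G (node u 0) (p n 1) + graph_dist G (p n 1) (node (route u t N) N)"
    using node_in_V[OF assms(1), of 0] inV[OF n(2)] m_ge node_in_V[OF route_less, of N]
    by (intro G.graph_dist_triangle) auto
  ultimately have "graph_dist G (node u 0) (node (route u t N) N)
      \<le> 1 + real n * (real m - 1) + (real m - 1)"
    using first[OF n(2)] m_ge by (simp add: of_nat_diff)
  also have "\<dots> = real m * real N - real N + 1"
    unfolding n(1)[symmetric] by (simp add: algebra_simps)
  finally show ?thesis .
qed

section \<open>Counting links over all routes\<close>

lemma sum_rotate:
  fixes g :: "nat \<Rightarrow> real"
  shows "(\<Sum>u<K. g ((u + c) mod K)) = (\<Sum>u<K. g u)"
proof -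
  have "inj_on (\<lambda>u. (u + c) mod K) {..<K}"
  proof (rule inj_on_inverseI)
    fix u assume "u \<in> {..<K}"
    \<comment> \<open>Adding \<open>c * (K - 1)\<close> undoes adding \<open>c\<close>, as their sum
      is a multiple of \<open>K\<close>.\<close>
    have "u + c + c * (K - 1) = u + c * K"
      using K_pos by (cases K) auto
    then show "((u + c) mod K + c * (K - 1)) mod K = u"
      using \<open>u \<in> {..<K}\<close> by (simp only: mod_add_left_eq) simp
  qed
  moreover have "(\<lambda>u. (u + c) mod K) ` {..<K} \<subseteq> {..<K}" using K_pos by auto
  ultimately have "bij_betw (\<lambda>u. (u + c) mod K) {..<K} {..<K}"
    by (simp add: bij_betw_def endo_inj_surj)
  then show ?thesis by (rule sum.reindex_bij_betw)
qed

text \<open>For fixed \<open>i\<close>, the map from the start \<open>u\<close> to the position on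
  level \<open>i\<close> is a rotation, so together the routes use each link of type
  \<open>t i\<close> there once.\<close>

lemma sum_route_len: "(\<Sum>u<K. route_len l u t N) = (\<Sum>i<N. \<Sum>z<K. l z i (t i))"
proof -
  have "(\<Sum>u<K. route_len l u t N) = (\<Sum>i<N. \<Sum>u<K. l ((u + off t i) mod K) i (t i))"
    unfolding route_len_def route_def by (rule sum.swap)
  also have "\<dots> = (\<Sum>i<N. \<Sum>z<K. l z i (t i))"
    by (intro sum.cong refl sum_rotate)
  finally show ?thesis .
qed

text \<open>Routes of constant type and routes of alternating type both traverse every link exactly once.\<close>

lemma sum_constant_eq_sum_alternating:
  "(\<Sum>b\<in>UNIV. \<Sum>u<K. route_len l u (\<lambda>_. b) N) = (\<Sum>b\<in>UNIV. \<Sum>u<K. route_len l u (\<lambda>k. b = even k) N)"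
proof -
  have "(\<Sum>z<K. l z i False) + (\<Sum>z<K. l z i True)
      = (\<Sum>z<K. l z i (False = even i)) + (\<Sum>z<K. l z i (True = even i))" for i
    by (cases "even i") auto
  then show ?thesis
    by (simp add: sum_route_len UNIV_bool sum.distrib[symmetric])
qed

section \<open>Excluding additive error \<open>C\<close>\<close>

text \<open>\<open>N\<close> satisfies \<open>N - 1 > 2 C\<close>; \<open>m\<close> is so large that
  the minima from \<open>pot_end\<close> are the route lengths, with \<open>\<mu>\<close> for
  \<open>H\<close> and with \<open>m - 2\<close> for \<open>G\<close>.\<close>

lemma not_quasi_isometry_weighted:
  assumes N: "N = 2 * C + 2" and m: "m = (N + 2) * (C + 4)" and w: "pos_edge_weighting H w"
  shows "\<not> quasi_isometry 1 (real C) V (graph_dist G) V (weighted_dist H w) id"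
proof
  assume "quasi_isometry 1 (real C) V (graph_dist G) V (weighted_dist H w) id"
  then have lower: "graph_dist G x y - C \<le> weighted_dist H w x y"
    and upper: "weighted_dist H w x y \<le> graph_dist G x y + C" if "x \<in> V" "y \<in> V" for x y
    using that by (auto simp: quasi_isometry_def)
  define l where "l z i t = (\<Sum>j<m. w (pt z i t j, pt z i t (Suc j)))" for z i t
  define \<mu> where "\<mu> = real m - 2 - real C"
  have m_real: "real m = (real N + 2) * (real C + 4)"
    by (simp add: m algebra_simps)
  have w_nonneg: "0 \<le> w e" if "e \<in> parcs H" for e
    using w that by (cases e) (auto simp: pos_edge_weighting_def less_imp_le)
  have \<mu>_nonneg: "0 \<le> \<mu>" by (simp add: \<mu>_def m_real algebra_simps)
  have dist_le_l: "weighted_dist H w (node z i) (node (up z i t) (Suc i)) \<le> l z i t"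
    if "z < K" "i < N" for z i t
    using H.weighted_dist_le_sum[of w "pt z i t" m] w_nonneg A_I that node_in_V[of z i]
    by (simp add: l_def H_def)
  have l_ge: "\<mu> \<le> l z i t" if "z < K" "i < N" for z i t
  proof -
    \<comment> \<open>The potential is the level times \<open>m - 2\<close>: shortcuts can save at
      most the two end edges of a link.\<close>
    have "real (Suc i) * (real m - 2) - real i * (real m - 2)
        \<le> graph_dist G (node z i) (node (up z i t) (Suc i))"
      using that up_less m_ge
      by (intro node_potential_le_graph_dist[where f="\<lambda>z i. real i * (real m - 2)"])
        (auto simp: algebra_simps)
    then have "real m - 2 \<le> graph_dist G (node z i) (node (up z i t) (Suc i))"
      by (simp add: algebra_simps)
    moreover have "node z i \<in> V" "node (up z i t) (Suc i) \<in> V"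
      using node_in_V up_less that by auto
    ultimately show ?thesis
      using dist_le_l[OF that, of t] lower unfolding \<mu>_def by fastforce
  qed
  have ends: "node u 0 \<in> V" "node (route u t N) N \<in> V" if "u < K" for u t
    using node_in_V route_less that by auto
  have alternating_type: "route_len l u t N \<le> real m * real N - real N + 1 + real C"
    if "u < K" and t: "\<And>k. t (Suc k) = (\<not> t k)" for u t
  proof -
    have "pot l \<mu> u t (route u t N) N - pot l \<mu> u t u 0
        \<le> weighted_dist H w (node u 0) (node (route u t N) N)"
      using w that route_less \<mu>_nonneg pot_step[of u _ _ \<mu> l t] l_ge
      by (intro node_potential_le_weighted_dist) (auto simp: l_def[symmetric])
    also have "\<dots> \<le> real m * real N - real N + 1 + real C"
      using upper[OF ends[OF \<open>u < K\<close>], of t] alternating_route_dist[of u t, OF that] \<open>u < K\<close> by simp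
    finally have "min (route_len l u t N) ((real N + 1) * \<mu>) \<le> real m * real N - real N + 1 + real C"
      using that \<mu>_nonneg by (simp add: pot_start pot_end)
    \<comment> \<open>The difference of the two sides is \<open>3 N + 5\<close>, so the minimum
      above is the route length.\<close>
    moreover have "real m * real N - real N + 1 + real C < (real N + 1) * \<mu>"
      by (simp add: \<mu>_def m_real algebra_simps)
    ultimately show ?thesis by (simp add: min_def split: if_splits)
  qed
  have const_type: "real m * real N - real C \<le> route_len l u (\<lambda>_. b) N" if "u < K" for u b
  proof -
    let ?t = "\<lambda>_::nat. b"
    \<comment> \<open>Link lengths in the potential for \<open>G\<close>: a route of constant type
      \<open>b\<close> meets only full links, of total length \<open>m N\<close>.\<close>
    define l' :: "nat \<Rightarrow> nat \<Rightarrow> bool \<Rightarrow> real"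
      where "l' = (\<lambda>z i t. if t = b then real m else real m - 2)"
    have "pot l' (real m - 2) u ?t (route u ?t N) N - pot l' (real m - 2) u ?t u 0
        \<le> graph_dist G (node u 0) (node (route u ?t N) N)"
    proof (rule node_potential_le_graph_dist)
      show "\<bar>pot l' (real m - 2) u ?t (up z i s) (Suc i) - pot l' (real m - 2) u ?t z i\<bar>
          \<le> (if s = b then real m else real m - 2)" if "z < K" "i < N" for z i s
        using pot_step[of u z i "real m - 2" l' ?t s] that \<open>u < K\<close> m_ge by (simp add: l'_def)
    qed (use that route_less in auto)
    then have "min (real m * real N) ((real N + 1) * (real m - 2))
        \<le> graph_dist G (node u 0) (node (route u ?t N) N)"
      using that m_ge by (simp add: pot_start pot_end route_len_def l'_def mult.commute)
    moreover have "real m * real N \<le> (real N + 1) * (real m - 2)"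
      by (simp add: m_real algebra_simps)
    \<comment> \<open>The route itself connects its ends, so its weight bounds their distance from
      above.\<close>
    moreover have "weighted_dist H w (node u 0) (node (route u ?t N) N) \<le> route_len l u ?t N"
    proof -
      have "weighted_dist H w (node u 0) (node (route u ?t i) i) \<le> route_len l u ?t i" if "i \<le> N" for i
        using that
      proof (induction i)
        case 0
        then show ?case
          using H.weighted_dist_le_sum[of w "\<lambda>_. node u 0" 0] ends[OF \<open>u < K\<close>] w_nonneg \<open>u < K\<close>
          by (simp add: route_0 route_len_def)
      next
        case (Suc i)
        have "weighted_dist H w (node u 0) (node (route u ?t (Suc i)) (Suc i))
          \<le> weighted_dist H w (node u 0) (node (route u ?t i) i)
            + weighted_dist H w (node (route u ?t i) i) (node (route u ?t (Suc i)) (Suc i))"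
          using ends[OF \<open>u < K\<close>] node_in_V route_less Suc.prems w_nonneg
          by (intro H.weighted_dist_triangle) auto
        also have "\<dots> \<le> route_len l u ?t i + l (route u ?t i) i b"
          using Suc dist_le_l[of "route u ?t i" i b] route_less by (intro add_mono) (auto simp: route_Suc)
        finally show ?case by (simp add: route_len_def)
      qed
      then show ?thesis by simp
    qed
    ultimately show ?thesis
      using lower[OF ends[OF that], of ?t] by (simp add: min_def)
  qed
  \<comment> \<open>Summed over both types and all starts, the two families have equal total weight;
    comparing the \<open>2 K\<close> equal bounds on either side leaves
    \<open>N - 1 \<le> 2 C\<close>.\<close>
  have "(\<Sum>b\<in>(UNIV :: bool set). \<Sum>u<K. real m * real N - real C)
      \<le> (\<Sum>b\<in>UNIV. \<Sum>u<K. route_len l u (\<lambda>_. b) N)"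
    using const_type by (intro sum_mono) auto
  also have "\<dots> = (\<Sum>b\<in>UNIV. \<Sum>u<K. route_len l u (\<lambda>k. b = even k) N)"
    by (rule sum_constant_eq_sum_alternating)
  also have "\<dots> \<le> (\<Sum>b\<in>(UNIV :: bool set). \<Sum>u<K. real m * real N - real N + 1 + real C)"
    by (intro sum_mono alternating_type) auto
  finally have "real m * real N - real C \<le> real m * real N - real N + 1 + real C"
    using K_pos by simp
  then show False by (simp add: N)
qed

end

theorem theorem1p4:
  shows "\<forall>C::nat. \<exists>(G :: nat pair_pre_digraph) (H :: nat pair_pre_digraph) (\<phi> :: nat \<Rightarrow> nat).
    pair_graph G \<and> Digraph_Component.connected (with_proj G) \<and>
    pair_graph H \<and> Digraph_Component.connected (with_proj H) \<and>
    quasi_isometry 2 1 (pverts G) (graph_dist G) (pverts H) (graph_dist H) \<phi> \<and>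
    (\<forall>w. pos_edge_weighting H w \<longrightarrow>
      \<not> quasi_isometry 1 (real C) (pverts G) (graph_dist G) (pverts H) (weighted_dist H w) \<phi>)"
proof
  fix C :: nat
  define N where "N = 2 * C + 2"
  define m where "m = (N + 2) * (C + 4)"
  interpret butterfly N m
    by unfold_locales (simp_all add: N_def m_def)
  have "pair_graph G" "pair_graph H"
    by unfold_locales
  then show "\<exists>(G :: nat pair_pre_digraph) (H :: nat pair_pre_digraph) (\<phi> :: nat \<Rightarrow> nat).
    pair_graph G \<and> Digraph_Component.connected (with_proj G) \<and>
    pair_graph H \<and> Digraph_Component.connected (with_proj H) \<and>
    quasi_isometry 2 1 (pverts G) (graph_dist G) (pverts H) (graph_dist H) \<phi> \<and>
    (\<forall>w. pos_edge_weighting H w \<longrightarrow>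
      \<not> quasi_isometry 1 (real C) (pverts G) (graph_dist G) (pverts H) (weighted_dist H w) \<phi>)"
    using G.connected H.connected quasi_isometry_id not_quasi_isometry_weighted[OF N_def m_def]
    by (intro exI[of _ G] exI[of _ H] exI[of _ id]) simp
qed

end
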